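(* Let $D\in\mathbb{Z}\setminus\{0,1\}$ be squarefree, $K=\mathbb{Q}(\sqrt{D})$ and $n\ge 1$. Then $\Gamma_K^n=\mathbb{Q}\left[z_1+\tau(z_1),\ \sqrt{D}(z_1-\tau(z_1)),\ \dots,\ z_n+\tau(z_n),\ \sqrt{D}(z_n-\tau(z_n))\right],$ i.e. $\Gamma_K^n$ is the $\mathbb{Q}$-subalgebra of the generalized polynomials generated by the $2n$ elements $z_k+\tau(z_k)$ and $\sqrt{D}(z_k-\tau(z_k))$, $k=1,\dots,n$.
   Context: $\tau: K\to K$, $a+b\sqrt{D}\mapsto a-b\sqrt{D}$ is the nontrivial automorphism. A generalized polynomial in $n$ variables over $K$ is a polynomial with coefficients in $K$ in the $2n$ independent indeterminates $z_1,\tau(z_1),\dots,z_n,\tau(z_n)$, written in multi-index notation as $g(\mathbf{z})=\sum_{\mathbf{i},\mathbf{j}\in\mathbb{Z}_{\ge0}^n}\alpha_{\mathbf{i}\mathbf{j}}\mathbf{z}^{\mathbf{i}}\tau(\mathbf{z})^{\mathbf{j}}$ (finitely many nonzero $\alpha_{\mathbf{i}\mathbf{j}}\in K$), where $\mathbf{z}^{\mathbf{i}}=z_1^{i_1}\cdots z_n^{i_n}$ and $\tau(\mathbf{z})^{\mathbf{j}}=\tau(z_1)^{j_1}\cdots\tau(z_n)^{j_n}$. It is evaluated at $\mathbf{a}\in K^n$ by substituting $a_k$ for $z_k$ and $\tau(a_k)$ for $\tau(z_k)$. $\Gamma_K^n$ denotes the ring of generalized polynomials $g$ in $n$ variables over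 $K$ such that $g(\mathbf{a})\in\mathbb{Q}$ for every $\mathbf{a}\in K^n$. *)

theory Defs
  imports
    "HOL-Analysis.Analysis"
    "HOL-Library.Poly_Mapping"
    "HOL-Library.Product_Plus"
    "HOL-Computational_Algebra.Squarefree"
begin

definition sqrtD :: "int \<Rightarrow> complex" where
  "sqrtD D = csqrt (of_int D)"

definition quad_field :: "int \<Rightarrow> complex set" where
  "quad_field D = {of_rat a + of_rat b * sqrtD D | a b :: rat. True}"

text \<open>Well defined on \<^term>\<open>quad_field D\<close> when \<^term>\<open>D\<close> is squarefree and different from 1
  (lemma \<open>tau_eq\<close> below); its values outside \<^term>\<open>quad_field D\<close> are irrelevant.\<close>

definition tau :: "int \<Rightarrow> complex \<Rightarrow> complex" where
  "tau D x = (THE y. \<exists>a b :: rat. x = of_rat a + of_rat b * sqrtD D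
                                 \<and> y = of_rat a - of_rat b * sqrtD D)"

text \<open>The monomial with exponent \<open>(i, j)\<close> stands for \<open>z\<^sup>i \<tau>(z)\<^sup>j\<close>; the coefficient
  \<open>\<alpha>\<^sub>i\<^sub>j\<close> of \<open>g\<close> is \<open>lookup g (i, j)\<close>. Multiplication on this type is convolution, i.e.
  multiplication of polynomials. The restrictions to coefficients in \<open>K\<close> and to the
  variables with index \<open>1, \<dots>, n\<close> are imposed in \<open>gen_polys\<close>.\<close>

type_synonym multi_index = "nat \<Rightarrow>\<^sub>0 nat"
type_synonym gpoly = "(multi_index \<times> multi_index) \<Rightarrow>\<^sub>0 complex"

definition gconst :: "complex \<Rightarrow> gpoly" where
  "gconst c = Poly_Mapping.single 0 c"

definition zvar :: "nat \<Rightarrow> gpoly" where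
  "zvar k = Poly_Mapping.single (Poly_Mapping.single k 1, 0) 1"

definition tau_zvar :: "nat \<Rightarrow> gpoly" where
  "tau_zvar k = Poly_Mapping.single (0, Poly_Mapping.single k 1) 1"

definition gen_polys :: "int \<Rightarrow> nat \<Rightarrow> gpoly set" where
  "gen_polys D n =
     {g. (\<forall>m. Poly_Mapping.lookup g m \<in> quad_field D) \<and>
         (\<forall>(i, j) \<in> Poly_Mapping.keys g.
            Poly_Mapping.keys i \<subseteq> {1..n} \<and> Poly_Mapping.keys j \<subseteq> {1..n})}"

definition geval :: "int \<Rightarrow> nat \<Rightarrow> gpoly \<Rightarrow> (nat \<Rightarrow> complex) \<Rightarrow> complex" where
  "geval D n g a =
     (\<Sum>(i, j) \<in> Poly_Mapping.keys g.
        Poly_Mapping.lookup g (i, j) *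
        (\<Prod>k = 1..n. a k ^ Poly_Mapping.lookup i k) *
        (\<Prod>k = 1..n. tau D (a k) ^ Poly_Mapping.lookup j k))"

definition Gamma_ring :: "int \<Rightarrow> nat \<Rightarrow> gpoly set" where
  "Gamma_ring D n =
     {g \<in> gen_polys D n. \<forall>a \<in> {1..n} \<rightarrow> quad_field D. geval D n g a \<in> \<rat>}"

definition rat_subalgebra :: "gpoly set \<Rightarrow> bool" where
  "rat_subalgebra A \<longleftrightarrow>
     1 \<in> A \<and>
     (\<forall>f\<in>A. \<forall>g\<in>A. f + g \<in> A) \<and>
     (\<forall>f\<in>A. \<forall>g\<in>A. f * g \<in> A) \<and>
     (\<forall>c\<in>\<rat>. \<forall>f\<in>A. gconst c * f \<in> A)"

definition rat_adjoin :: "gpoly set \<Rightarrow> gpoly set" where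
  "rat_adjoin S = rat_subalgebra hull S"

lemma sqrtD_squared: "sqrtD D ^ 2 = of_int D"
  by (simp add: sqrtD_def)

lemma squarefree_not_rat_square:
  fixes D :: int and r :: rat
  assumes "squarefree D" "D \<noteq> 1"
  shows "r ^ 2 \<noteq> of_int D"
proof
  assume eq: "r ^ 2 = of_int D"
  obtain p q where pq: "quotient_of r = (p, q)" by force
  have q: "q > 0" "coprime p q" "r = of_int p / of_int q"
    using quotient_of_denom_pos[OF pq] quotient_of_coprime[OF pq] quotient_of_div[OF pq]
    by auto
  have "of_int (p ^ 2) = (of_int (D * q ^ 2) :: rat)"
    using eq q by (simp add: field_simps power_divide)
  hence pD: "p ^ 2 = D * q ^ 2" by (simp only: of_int_eq_iff)
  hence "q dvd p ^ 2" by (simp add: power2_eq_square)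
  with q(2) have "is_unit q"
    by (meson coprime_commute coprime_common_divisor coprime_power_left_iff dvd_refl
        coprime_power_right_iff)
  with q(1) have "q = 1" by simp
  with pD have "p ^ 2 = D" by simp
  moreover from this assms(1) have "is_unit p"
    by (metis dvd_refl squarefreeD)
  ultimately have "D = 1"
    by (auto simp: power2_eq_1_iff)
  with assms(2) show False by simp
qed

lemma quad_repr_unique:
  fixes a b c d :: rat
  assumes "squarefree D" "D \<noteq> 1"
    and eq: "of_rat a + of_rat b * sqrtD D = of_rat c + of_rat d * sqrtD D"
  shows "a = c \<and> b = d"
proof -
  have "b = d"
  proof (rule ccontr)
    assume "b \<noteq> d"
    hence nz: "(of_rat (b - d) :: complex) \<noteq> 0" by simp
    have "of_rat (b - d) * sqrtD D = of_rat (c - a)"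
      using eq by (simp add: of_rat_diff algebra_simps)
    hence "sqrtD D = of_rat (c - a) / of_rat (b - d)"
      using nz by (simp add: nonzero_eq_divide_eq mult.commute)
    hence "sqrtD D = of_rat ((c - a) / (b - d))"
      by (simp only: of_rat_divide)
    hence "of_rat (((c - a) / (b - d)) ^ 2) = (of_rat (of_int D) :: complex)"
      using sqrtD_squared[of D] by (simp only: of_rat_power of_rat_of_int_eq)
    hence "((c - a) / (b - d)) ^ 2 = of_int D" by (simp only: of_rat_eq_iff)
    with squarefree_not_rat_square[OF assms(1,2)] show False by blast
  qed
  with eq show ?thesis by simp
qed

lemma tau_eq:
  fixes a b :: rat
  assumes "squarefree D" "D \<noteq> 1"
  shows "tau D (of_rat a + of_rat b * sqrtD D) = of_rat a - of_rat b * sqrtD D"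
  unfolding tau_def
  by (rule the_equality) (auto dest: quad_repr_unique[OF assms])

end

theory Submission
  imports Defs
begin

text \<open>Let \<open>A\<close> be the \<open>\<rat>\<close>-algebra generated by \<open>z\<^sub>k + \<tau>(z\<^sub>k)\<close> and
  \<open>\<surd>D (z\<^sub>k - \<tau>(z\<^sub>k))\<close>. Over \<open>K\<close> these elements span the same space as \<open>z\<^sub>k\<close> and
  \<open>\<tau>(z\<^sub>k)\<close>, so every generalized polynomial has the form \<open>g = p + \<surd>D q\<close> with \<open>p, q \<in> A\<close>.
  Elements of \<open>A\<close> take rational values, so if \<open>g\<close> does too, then \<open>q\<close> vanishes on \<open>K\<^sup>n\<close>,
  since \<open>\<surd>D\<close> is irrational. Writing \<open>z\<^sub>k = a\<^sub>k + b\<^sub>k \<surd>D\<close>, this says that a polynomial in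
  \<open>2n\<close> variables vanishes at all rational points; hence it vanishes identically, and \<open>q = 0\<close>.\<close>

section \<open>Evaluation as a ring homomorphism\<close>

lemma sum_keys_single: "(\<Sum>m\<in>Poly_Mapping.keys f. Poly_Mapping.single m (Poly_Mapping.lookup f m)) = f"
  by (rule poly_mapping_eqI)
    (simp add: lookup_sum lookup_single when_def in_keys_iff)

lemma times_poly_mapping_eq_sum_single:
  "f * g = (\<Sum>m\<in>Poly_Mapping.keys f. \<Sum>m'\<in>Poly_Mapping.keys g.
     Poly_Mapping.single (m + m') (Poly_Mapping.lookup f m * Poly_Mapping.lookup g m'))"
proof -
  have "f * g = (\<Sum>m\<in>Poly_Mapping.keys f. Poly_Mapping.single m (Poly_Mapping.lookup f m)) *
     (\<Sum>m\<in>Poly_Mapping.keys g. Poly_Mapping.single m (Poly_Mapping.lookup g m))"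
    by (simp only: sum_keys_single)
  also have "\<dots> = (\<Sum>m\<in>Poly_Mapping.keys f. \<Sum>m'\<in>Poly_Mapping.keys g.
     Poly_Mapping.single (m + m') (Poly_Mapping.lookup f m * Poly_Mapping.lookup g m'))"
    by (simp add: sum_product mult_single)
  finally show ?thesis .
qed

text \<open>The weight of a monomial is left arbitrary: additivity holds for every weight, and
  weights multiplicative in the exponent also respect products.\<close>

definition lin_eval :: "('a \<Rightarrow> 'b) \<Rightarrow> ('a \<Rightarrow>\<^sub>0 'b::comm_semiring_1) \<Rightarrow> 'b" where
  "lin_eval \<phi> g = (\<Sum>m\<in>Poly_Mapping.keys g. Poly_Mapping.lookup g m * \<phi> m)"

text \<open>Cancellation can remove keys from a sum, so additivity needs a common index set for both
  summands and their sum.\<close>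

lemma lin_eval_superset:
  assumes "finite M" "Poly_Mapping.keys g \<subseteq> M"
  shows "lin_eval \<phi> g = (\<Sum>m\<in>M. Poly_Mapping.lookup g m * \<phi> m)"
  unfolding lin_eval_def using assms
  by (intro sum.mono_neutral_left) (auto simp: in_keys_iff)

lemma lin_eval_zero [simp]: "lin_eval \<phi> 0 = 0"
  by (simp add: lin_eval_def)

lemma lin_eval_add: "lin_eval \<phi> (f + g) = lin_eval \<phi> f + lin_eval \<phi> g"
proof -
  let ?M = "Poly_Mapping.keys f \<union> Poly_Mapping.keys g"
  have "lin_eval \<phi> h = (\<Sum>m\<in>?M. Poly_Mapping.lookup h m * \<phi> m)" if "h \<in> {f, g, f + g}" for h
    using that keys_add[of f g] by (intro lin_eval_superset) auto
  then show ?thesis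
    by (simp add: lookup_add distrib_right sum.distrib)
qed

lemma lin_eval_sum: "lin_eval \<phi> (\<Sum>x\<in>X. h x) = (\<Sum>x\<in>X. lin_eval \<phi> (h x))"
  by (induction X rule: infinite_finite_induct) (auto simp: lin_eval_add)

lemma lin_eval_single [simp]: "lin_eval \<phi> (Poly_Mapping.single m c) = c * \<phi> m"
  by (simp add: lin_eval_def)

lemma lin_eval_mult:
  fixes f g :: "'a::monoid_add \<Rightarrow>\<^sub>0 'b::comm_semiring_1"
  assumes "\<And>m m'. \<phi> (m + m') = \<phi> m * \<phi> m'"
  shows "lin_eval \<phi> (f * g) = lin_eval \<phi> f * lin_eval \<phi> g"
proof -
  have "lin_eval \<phi> (f * g) = (\<Sum>m\<in>Poly_Mapping.keys f. \<Sum>m'\<in>Poly_Mapping.keys g.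
     (Poly_Mapping.lookup f m * \<phi> m) * (Poly_Mapping.lookup g m' * \<phi> m'))"
    by (simp add: times_poly_mapping_eq_sum_single[of f g] lin_eval_sum assms mult_ac)
  then show ?thesis
    by (simp add: lin_eval_def sum_product)
qed

text \<open>The values \<open>y\<close> substituted for the conjugate variables are independent of
  \<open>x\<close>. \<open>geval\<close> is the special case where \<open>y\<close> is the conjugate
  of \<open>x\<close>; the vanishing argument needs arbitrary pairs.\<close>

definition monom_eval :: "nat \<Rightarrow> (nat \<Rightarrow> complex) \<Rightarrow> (nat \<Rightarrow> complex) \<Rightarrow> multi_index \<times> multi_index \<Rightarrow> complex" where
  "monom_eval n x y m =
     (\<Prod>k = 1..n. x k ^ Poly_Mapping.lookup (fst m) k) * (\<Prod>k = 1..n. y k ^ Poly_Mapping.lookup (snd m) k)"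

lemma monom_eval_zero [simp]: "monom_eval n x y 0 = 1"
  by (simp add: monom_eval_def)

lemma monom_eval_add: "monom_eval n x y (m + m') = monom_eval n x y m * monom_eval n x y m'"
  by (simp add: monom_eval_def lookup_add power_add prod.distrib)

lemma geval_eq_lin_eval: "geval D n g a = lin_eval (monom_eval n a (\<lambda>k. tau D (a k))) g"
  by (simp add: geval_def lin_eval_def monom_eval_def case_prod_beta mult.assoc)

lemma geval_add: "geval D n (f + g) a = geval D n f a + geval D n g a"
  by (simp add: geval_eq_lin_eval lin_eval_add)

lemma geval_mult: "geval D n (f * g) a = geval D n f a * geval D n g a"
  by (simp add: geval_eq_lin_eval lin_eval_mult monom_eval_add)

lemma geval_gconst [simp]: "geval D n (gconst c) a = c"
  by (simp add: geval_eq_lin_eval gconst_def)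

lemma geval_one [simp]: "geval D n 1 a = 1"
  using geval_gconst[of D n 1 a] by (simp add: gconst_def)

lemma prod_power_lookup_single:
  fixes x :: "'a \<Rightarrow> 'b::comm_monoid_mult"
  assumes "finite A" "k \<in> A"
  shows "(\<Prod>l\<in>A. x l ^ Poly_Mapping.lookup (Poly_Mapping.single k (Suc 0)) l) = x k"
proof -
  have "(\<Prod>l\<in>A. x l ^ Poly_Mapping.lookup (Poly_Mapping.single k (Suc 0)) l) =
      (\<Prod>l\<in>A. if l = k then x l else 1)"
    by (intro prod.cong) (auto simp: lookup_single when_def)
  then show ?thesis
    using assms by simp
qed

lemma geval_zvar: "k \<in> {1..n} \<Longrightarrow> geval D n (zvar k) a = a k"
  by (simp add: geval_eq_lin_eval zvar_def monom_eval_def prod_power_lookup_single)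

lemma geval_tau_zvar: "k \<in> {1..n} \<Longrightarrow> geval D n (tau_zvar k) a = tau D (a k)"
  by (simp add: geval_eq_lin_eval tau_zvar_def monom_eval_def prod_power_lookup_single)

section \<open>Closure properties of K and of the generalized polynomials\<close>

lemma quad_fieldI: "of_rat a + of_rat b * sqrtD D \<in> quad_field D"
  by (auto simp: quad_field_def)

lemma quad_fieldE:
  assumes "x \<in> quad_field D"
  obtains a b where "x = of_rat a + of_rat b * sqrtD D"
  using assms by (auto simp: quad_field_def)

lemma Rats_subset_quad_field: "c \<in> \<rat> \<Longrightarrow> c \<in> quad_field D"
  using quad_fieldI[of _ 0 D] by (auto elim: Rats_cases)

lemma sqrtD_in_quad_field: "sqrtD D \<in> quad_field D"
  using quad_fieldI[of 0 1 D] by simp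

lemma quad_field_add: "x \<in> quad_field D \<Longrightarrow> y \<in> quad_field D \<Longrightarrow> x + y \<in> quad_field D"
proof (elim quad_fieldE)
  fix a b c d
  assume "x = of_rat a + of_rat b * sqrtD D" "y = of_rat c + of_rat d * sqrtD D"
  then have "x + y = of_rat (a + c) + of_rat (b + d) * sqrtD D"
    by (simp add: of_rat_add algebra_simps)
  then show ?thesis
    by (simp add: quad_fieldI)
qed

lemma quad_field_mult: "x \<in> quad_field D \<Longrightarrow> y \<in> quad_field D \<Longrightarrow> x * y \<in> quad_field D"
proof (elim quad_fieldE)
  fix a b c d
  assume "x = of_rat a + of_rat b * sqrtD D" "y = of_rat c + of_rat d * sqrtD D"
  then have "x * y = of_rat (a * c) + of_rat (b * d) * sqrtD D ^ 2 + of_rat (a * d + b * c) * sqrtD D"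
    by (simp add: of_rat_add of_rat_mult algebra_simps power2_eq_square)
  also have "\<dots> = of_rat (a * c + b * d * of_int D) + of_rat (a * d + b * c) * sqrtD D"
    by (simp add: sqrtD_squared of_rat_add of_rat_mult)
  finally show ?thesis
    by (simp add: quad_fieldI)
qed

lemma zero_in_quad_field [simp]: "0 \<in> quad_field D"
  by (simp add: Rats_subset_quad_field)

lemma one_in_quad_field [simp]: "1 \<in> quad_field D"
  by (simp add: Rats_subset_quad_field)

lemma gen_polysD:
  assumes "g \<in> gen_polys D n"
  shows "Poly_Mapping.lookup g m \<in> quad_field D"
    and "m \<in> Poly_Mapping.keys g \<Longrightarrow> Poly_Mapping.keys (fst m) \<subseteq> {1..n}"
    and "m \<in> Poly_Mapping.keys g \<Longrightarrow> Poly_Mapping.keys (snd m) \<subseteq> {1..n}"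
  using assms unfolding gen_polys_def case_prod_beta by blast+

lemma gen_polys_zero [simp]: "0 \<in> gen_polys D n"
  by (simp add: gen_polys_def)

lemma gen_polys_add: "f \<in> gen_polys D n \<Longrightarrow> g \<in> gen_polys D n \<Longrightarrow> f + g \<in> gen_polys D n"
  using keys_add[of f g] by (fastforce simp: gen_polys_def lookup_add quad_field_add)

lemma gen_polys_sum: "(\<And>x. x \<in> X \<Longrightarrow> h x \<in> gen_polys D n) \<Longrightarrow> (\<Sum>x\<in>X. h x) \<in> gen_polys D n"
  by (induction X rule: infinite_finite_induct) (auto simp: gen_polys_add)

lemma gen_polys_single:
  assumes "c \<in> quad_field D" "Poly_Mapping.keys (fst m) \<subseteq> {1..n}" "Poly_Mapping.keys (snd m) \<subseteq> {1..n}"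
  shows "Poly_Mapping.single m c \<in> gen_polys D n"
  using assms by (auto simp: gen_polys_def lookup_single when_def)

lemma gen_polys_mult:
  assumes "f \<in> gen_polys D n" "g \<in> gen_polys D n"
  shows "f * g \<in> gen_polys D n"
proof -
  have *: "Poly_Mapping.single (m + m') (Poly_Mapping.lookup f m * Poly_Mapping.lookup g m') \<in> gen_polys D n"
    if "m \<in> Poly_Mapping.keys f" "m' \<in> Poly_Mapping.keys g" for m m'
  proof (rule gen_polys_single)
    show "Poly_Mapping.lookup f m * Poly_Mapping.lookup g m' \<in> quad_field D"
      using assms by (intro quad_field_mult gen_polysD)
    show "Poly_Mapping.keys (fst (m + m')) \<subseteq> {1..n}" "Poly_Mapping.keys (snd (m + m')) \<subseteq> {1..n}"
      using gen_polysD(2,3)[OF assms(1) that(1)] gen_polysD(2,3)[OF assms(2) that(2)]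
        keys_add[of "fst m" "fst m'"] keys_add[of "snd m" "snd m'"]
      unfolding fst_add snd_add by blast+
  qed
  show ?thesis
    unfolding times_poly_mapping_eq_sum_single[of f g]
    by (intro gen_polys_sum *)
qed

lemma gconst_in_gen_polys: "c \<in> quad_field D \<Longrightarrow> gconst c \<in> gen_polys D n"
  unfolding gconst_def by (rule gen_polys_single) auto

lemma zvar_in_gen_polys: "k \<in> {1..n} \<Longrightarrow> zvar k \<in> gen_polys D n"
  unfolding zvar_def by (rule gen_polys_single) auto

lemma tau_zvar_in_gen_polys: "k \<in> {1..n} \<Longrightarrow> tau_zvar k \<in> gen_polys D n"
  unfolding tau_zvar_def by (rule gen_polys_single) auto

lemma gconst_mult: "gconst c * gconst d = gconst (c * d)"
  by (simp add: gconst_def mult_single)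

lemma gconst_add: "gconst c + gconst d = gconst (c + d)"
  by (simp add: gconst_def single_add)

lemma gconst_one [simp]: "gconst 1 = 1"
  by (simp add: gconst_def)

lemma gconst_zero [simp]: "gconst 0 = 0"
  by (simp add: gconst_def)

text \<open>Reduces subtraction to the operations that \<open>rat_subalgebra\<close> and the rules
  for \<open>geval\<close> cover.\<close>

lemma diff_eq_add_gconst: "f - g = f + gconst (-1) * g"
  by (simp add: gconst_def single_uminus)

lemma gen_polys_diff: "f \<in> gen_polys D n \<Longrightarrow> g \<in> gen_polys D n \<Longrightarrow> f - g \<in> gen_polys D n"
  unfolding diff_eq_add_gconst
  by (intro gen_polys_add gen_polys_mult gconst_in_gen_polys Rats_subset_quad_field) auto

section \<open>The generated algebra takes rational values\<close>

lemma rat_subalgebra_Gamma_ring: "rat_subalgebra (Gamma_ring D n)"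
  unfolding rat_subalgebra_def
proof (intro conjI ballI)
  have "gconst 1 \<in> gen_polys D n"
    by (rule gconst_in_gen_polys) simp
  then show "1 \<in> Gamma_ring D n"
    by (simp add: Gamma_ring_def)
next
  fix f g assume "f \<in> Gamma_ring D n" "g \<in> Gamma_ring D n"
  then show "f + g \<in> Gamma_ring D n" "f * g \<in> Gamma_ring D n"
    by (auto simp: Gamma_ring_def geval_add geval_mult gen_polys_add gen_polys_mult)
next
  fix c :: complex and f assume "c \<in> \<rat>" "f \<in> Gamma_ring D n"
  then show "gconst c * f \<in> Gamma_ring D n"
    by (auto simp: Gamma_ring_def geval_mult
        intro!: gen_polys_mult gconst_in_gen_polys Rats_subset_quad_field)
qed

abbreviation (input) gamma_gens :: "int \<Rightarrow> nat \<Rightarrow> gpoly set" where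
  "gamma_gens D n \<equiv>
     (\<Union>k\<in>{1..n}. {zvar k + tau_zvar k, gconst (sqrtD D) * (zvar k - tau_zvar k)})"

text \<open>At a point with k-th coordinate \<open>p + q * sqrtD D\<close> the two generators take
  the rational values \<open>2 * p\<close> and \<open>2 * q * D\<close>.\<close>

lemma gamma_gens_subset_Gamma_ring:
  assumes "squarefree D" "D \<noteq> 1"
  shows "gamma_gens D n \<subseteq> Gamma_ring D n"
proof -
  have "zvar k + tau_zvar k \<in> Gamma_ring D n \<and> gconst (sqrtD D) * (zvar k - tau_zvar k) \<in> Gamma_ring D n"
    if k: "k \<in> {1..n}" for k
  proof -
    have "geval D n (zvar k + tau_zvar k) a \<in> \<rat> \<and>
        geval D n (gconst (sqrtD D) * (zvar k - tau_zvar k)) a \<in> \<rat>"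
      if "a \<in> {1..n} \<rightarrow> quad_field D" for a
    proof -
      have "a k \<in> quad_field D"
        using that k by blast
      then obtain p q where pq: "a k = of_rat p + of_rat q * sqrtD D"
        by (rule quad_fieldE)
      have "geval D n (zvar k + tau_zvar k) a = 2 * of_rat p"
        by (simp add: geval_add geval_zvar[OF k] geval_tau_zvar[OF k] pq tau_eq[OF assms])
      moreover have "geval D n (gconst (sqrtD D) * (zvar k - tau_zvar k)) a = 2 * of_rat q * sqrtD D ^ 2"
        by (simp add: diff_eq_add_gconst geval_add geval_mult geval_zvar[OF k] geval_tau_zvar[OF k]
            pq tau_eq[OF assms] power2_eq_square)
      ultimately show ?thesis
        by (simp add: sqrtD_squared)
    qed
    then show ?thesis
      using k by (auto simp: Gamma_ring_def intro!: gen_polys_add gen_polys_mult gen_polys_diff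
          gconst_in_gen_polys zvar_in_gen_polys tau_zvar_in_gen_polys sqrtD_in_quad_field)
  qed
  then show ?thesis
    by auto
qed

section \<open>Decomposition over the generated algebra\<close>

lemma rat_subalgebra_rat_adjoin: "rat_subalgebra (rat_adjoin S)"
  unfolding rat_adjoin_def by (rule hull_in) (auto simp: rat_subalgebra_def)

lemma rat_adjoin_superset: "S \<subseteq> rat_adjoin S"
  unfolding rat_adjoin_def by (rule hull_subset)

lemma rat_adjoin_minimal: "S \<subseteq> A \<Longrightarrow> rat_subalgebra A \<Longrightarrow> rat_adjoin S \<subseteq> A"
  unfolding rat_adjoin_def by (rule hull_minimal)

text \<open>Serves as an induction principle: a generalized polynomial is a finite sum of products
  of constants and variables.\<close>

lemma gen_polys_subset_subring:
  assumes B_add: "\<And>f g. f \<in> B \<Longrightarrow> g \<in> B \<Longrightarrow> f + g \<in> B"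
    and B_mult: "\<And>f g. f \<in> B \<Longrightarrow> g \<in> B \<Longrightarrow> f * g \<in> B"
    and B_const: "\<And>c. c \<in> quad_field D \<Longrightarrow> gconst c \<in> B"
    and B_var: "\<And>k. k \<in> {1..n} \<Longrightarrow> zvar k \<in> B" "\<And>k. k \<in> {1..n} \<Longrightarrow> tau_zvar k \<in> B"
  shows "gen_polys D n \<subseteq> B"
proof
  fix g assume g: "g \<in> gen_polys D n"
  have one: "1 \<in> B" and zero: "0 \<in> B"
    using B_const[of 1] B_const[of 0] by simp_all
  have sum: "(\<Sum>x\<in>X. h x) \<in> B" if "\<And>x. x \<in> X \<Longrightarrow> h x \<in> B" for X :: "(multi_index \<times> multi_index) set" and h
    using that by (induction X rule: infinite_finite_induct) (auto simp: zero B_add)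
  \<comment> \<open>The additive map \<iota> places a multi-index in the first or the second
    component, so one argument treats the monomials in z and in tau(z).\<close>
  have mono: "Poly_Mapping.single (\<iota> i) 1 \<in> B"
    if i: "Poly_Mapping.keys i \<subseteq> {1..n}"
      and \<iota>: "\<iota> 0 = 0" "\<And>i j. \<iota> (i + j) = \<iota> i + \<iota> j"
      and var: "\<And>k. k \<in> {1..n} \<Longrightarrow> Poly_Mapping.single (\<iota> (Poly_Mapping.single k 1)) 1 \<in> B"
    for i :: multi_index and \<iota>
  proof -
    have pow: "Poly_Mapping.single (\<iota> (Poly_Mapping.single k e)) 1 \<in> B" if "k \<in> {1..n}" for k e
    proof (induction e)
      case (Suc e)
      have "Poly_Mapping.single (\<iota> (Poly_Mapping.single k (Suc e))) (1::complex) =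
          Poly_Mapping.single (\<iota> (Poly_Mapping.single k 1)) 1 * Poly_Mapping.single (\<iota> (Poly_Mapping.single k e)) 1"
        by (simp add: mult_single flip: \<iota>(2) single_add)
      with Suc var[OF that] B_mult show ?case
        by metis
    qed (simp add: \<iota> one)
    \<comment> \<open>A multi-index is the sum of its one-variable parts, so its monomial is a
      product of powers of single variables.\<close>
    have "Poly_Mapping.single (\<iota> (\<Sum>k\<in>X. Poly_Mapping.single k (Poly_Mapping.lookup i k))) 1 \<in> B"
      if "X \<subseteq> {1..n}" for X
      using finite_subset[OF that finite_atLeastAtMost] that
    proof (induction X rule: finite_induct)
      case (insert k X)
      then have "Poly_Mapping.single (\<iota> (Poly_Mapping.single k (Poly_Mapping.lookup i k))) 1 *
          Poly_Mapping.single (\<iota> (\<Sum>k\<in>X. Poly_Mapping.single k (Poly_Mapping.lookup i k))) 1 \<in> B"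
        by (intro B_mult pow) auto
      then show ?case
        using insert by (simp add: mult_single \<iota>)
    qed (simp add: \<iota> one)
    from this[OF i] show ?thesis
      by (simp add: sum_keys_single)
  qed
  have "Poly_Mapping.single m (Poly_Mapping.lookup g m) \<in> B" if "m \<in> Poly_Mapping.keys g" for m
  proof -
    have keys: "Poly_Mapping.keys (fst m) \<subseteq> {1..n}" "Poly_Mapping.keys (snd m) \<subseteq> {1..n}"
      and c: "Poly_Mapping.lookup g m \<in> quad_field D"
      using gen_polysD[OF g] that by blast+
    have 1: "Poly_Mapping.single (fst m, 0) 1 \<in> B"
      using mono[of "fst m" "\<lambda>i. (i, 0)"] keys B_var by (simp add: zvar_def zero_prod_def)
    have 2: "Poly_Mapping.single (0, snd m) 1 \<in> B"
      using mono[of "snd m" "\<lambda>j. (0, j)"] keys B_var by (simp add: tau_zvar_def zero_prod_def)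
    have "Poly_Mapping.single m (Poly_Mapping.lookup g m) =
        gconst (Poly_Mapping.lookup g m) * (Poly_Mapping.single (fst m, 0) 1 * Poly_Mapping.single (0, snd m) 1)"
      by (simp add: gconst_def mult_single)
    then show ?thesis
      using B_mult[OF B_const[OF c] B_mult[OF 1 2]] by simp
  qed
  then have "(\<Sum>m\<in>Poly_Mapping.keys g. Poly_Mapping.single m (Poly_Mapping.lookup g m)) \<in> B"
    by (rule sum)
  then show "g \<in> B"
    by (simp only: sum_keys_single)
qed

text \<open>With A the generated algebra, A + sqrt(D) A is closed under products because the square
  of sqrt(D) is rational. It contains the variables because 2 and D are invertible in the
  rationals.\<close>

lemma gen_polys_decomposition:
  assumes "D \<noteq> 0" "g \<in> gen_polys D n"
  obtains p q where "p \<in> rat_adjoin (gamma_gens D n)" "q \<in> rat_adjoin (gamma_gens D n)"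
    "g = p + gconst (sqrtD D) * q"
proof -
  define A where "A = rat_adjoin (gamma_gens D n)"
  let ?s = "gconst (sqrtD D)"
  have s2: "?s * ?s = gconst (of_int D)"
    unfolding gconst_mult using sqrtD_squared[of D] by (simp add: power2_eq_square)
  have A_one: "1 \<in> A" and A_add: "\<And>f g. f \<in> A \<Longrightarrow> g \<in> A \<Longrightarrow> f + g \<in> A"
    and A_mult: "\<And>f g. f \<in> A \<Longrightarrow> g \<in> A \<Longrightarrow> f * g \<in> A"
    and A_smult: "\<And>c f. c \<in> \<rat> \<Longrightarrow> f \<in> A \<Longrightarrow> gconst c * f \<in> A"
    using rat_subalgebra_rat_adjoin[of "gamma_gens D n"]
    unfolding A_def[symmetric] rat_subalgebra_def by blast+
  have A_const: "gconst c \<in> A" if "c \<in> \<rat>" for c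
    using A_smult[OF that A_one] by simp
  define B where "B = {p + ?s * q | p q. p \<in> A \<and> q \<in> A}"
  have BI: "p + ?s * q \<in> B" if "p \<in> A" "q \<in> A" for p q
    using that by (auto simp: B_def)
  have "gen_polys D n \<subseteq> B"
  proof (rule gen_polys_subset_subring)
    fix f g assume "f \<in> B" "g \<in> B"
    then obtain p q p' q' where pq: "p \<in> A" "q \<in> A" "p' \<in> A" "q' \<in> A"
      and f: "f = p + ?s * q" and g: "g = p' + ?s * q'"
      by (auto simp: B_def)
    have "f + g = (p + p') + ?s * (q + q')"
      by (simp add: f g algebra_simps)
    then show "f + g \<in> B"
      using pq by (auto intro!: BI A_add)
    have "f * g = (p * p' + (?s * ?s) * (q * q')) + ?s * (p * q' + q * p')"
      by (simp add: f g algebra_simps)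
    then show "f * g \<in> B"
      unfolding s2 using pq by (auto intro!: BI A_add A_mult A_smult)
  next
    fix c assume "c \<in> quad_field D"
    then obtain a b where "c = of_rat a + of_rat b * sqrtD D"
      by (rule quad_fieldE)
    then have "gconst c = gconst (of_rat a) + ?s * gconst (of_rat b)"
      by (simp add: gconst_mult gconst_add mult.commute)
    then show "gconst c \<in> B"
      by (auto intro!: BI A_const)
  next
    fix k assume k: "k \<in> {1..n}"
    let ?u = "zvar k + tau_zvar k" and ?v = "?s * (zvar k - tau_zvar k)"
    \<comment> \<open>Since \<open>?s * ?v\<close> is D times the difference of the two variables,
      \<open>?d\<close> scales it to half that difference; adding it to or subtracting it from
      \<open>?h * ?u\<close> recovers each variable.\<close>
    let ?h = "gconst (1 / 2)" and ?d = "gconst (1 / (2 * of_int D))"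
    have uv: "?u \<in> A" "?v \<in> A"
      using rat_adjoin_superset[of "gamma_gens D n"] k unfolding A_def by blast+
    have sd: "?s * ?s * ?d = ?h"
      unfolding s2 unfolding gconst_mult using assms(1) by simp
    have hh: "?h + ?h = 1"
      by (simp add: gconst_add)
    have sv: "?s * (?d * ?v) = ?h * (zvar k - tau_zvar k)"
      by (simp only: mult_ac flip: sd)
    have "(?h + ?h) * zvar k = ?h * ?u + ?h * (zvar k - tau_zvar k)"
      "(?h + ?h) * tau_zvar k = ?h * ?u - ?h * (zvar k - tau_zvar k)"
      by (simp_all add: algebra_simps)
    then have "zvar k = ?h * ?u + ?s * (?d * ?v)" "tau_zvar k = ?h * ?u + ?s * (gconst (-1) * (?d * ?v))"
      unfolding hh sv diff_eq_add_gconst[of "?h * ?u"] mult.left_commute[of ?s "gconst (-1)"] by simp_all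
    moreover have "?h * ?u \<in> A" "?d * ?v \<in> A" "gconst (-1) * (?d * ?v) \<in> A"
      using uv by (auto intro!: A_smult)
    ultimately show "zvar k \<in> B" "tau_zvar k \<in> B"
      using BI by metis+
  qed
  with assms(2) that show ?thesis
    unfolding B_def A_def by blast
qed

section \<open>Functions that are polynomial in each coordinate\<close>

definition poly_fun :: "('a::comm_ring_1 \<Rightarrow> 'a) \<Rightarrow> bool" where
  "poly_fun f \<longleftrightarrow> (\<exists>p. f = poly p)"

lemma poly_fun_const: "poly_fun (\<lambda>t. c)"
  unfolding poly_fun_def by (rule exI[of _ "[:c:]"]) auto

lemma poly_fun_ident: "poly_fun (\<lambda>t. t)"
  unfolding poly_fun_def by (rule exI[of _ "[:0, 1:]"]) auto

lemma poly_fun_add: "poly_fun f \<Longrightarrow> poly_fun g \<Longrightarrow> poly_fun (\<lambda>t. f t + g t)"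
  unfolding poly_fun_def by (auto simp flip: poly_add)

lemma poly_fun_mult: "poly_fun f \<Longrightarrow> poly_fun g \<Longrightarrow> poly_fun (\<lambda>t. f t * g t)"
  unfolding poly_fun_def by (auto simp flip: poly_mult)

lemma poly_fun_diff: "poly_fun f \<Longrightarrow> poly_fun g \<Longrightarrow> poly_fun (\<lambda>t. f t - g t)"
  unfolding poly_fun_def by (auto simp flip: poly_diff)

lemma poly_fun_power: "poly_fun f \<Longrightarrow> poly_fun (\<lambda>t. f t ^ e)"
  by (induction e) (auto intro: poly_fun_const poly_fun_mult)

lemma poly_fun_sum: "(\<And>x. x \<in> X \<Longrightarrow> poly_fun (f x)) \<Longrightarrow> poly_fun (\<lambda>t. \<Sum>x\<in>X. f x t)"
  by (induction X rule: infinite_finite_induct) (auto intro: poly_fun_const poly_fun_add)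

lemma poly_fun_prod: "(\<And>x. x \<in> X \<Longrightarrow> poly_fun (f x)) \<Longrightarrow> poly_fun (\<lambda>t. \<Prod>x\<in>X. f x t)"
  by (induction X rule: infinite_finite_induct) (auto intro: poly_fun_const poly_fun_mult)

lemmas poly_fun_intros = poly_fun_const poly_fun_ident poly_fun_add poly_fun_mult poly_fun_diff
  poly_fun_power poly_fun_sum poly_fun_prod

text \<open>A nonzero polynomial over an integral domain has only finitely many roots.\<close>

lemma poly_fun_eq_0:
  fixes f :: "'a::idom \<Rightarrow> 'a"
  assumes "poly_fun f" "infinite Q" "\<And>t. t \<in> Q \<Longrightarrow> f t = 0"
  shows "f t = 0"
proof -
  obtain p where p: "f = poly p"
    using assms(1) by (auto simp: poly_fun_def)
  have "infinite {t. poly p t = 0}"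
    using assms(2,3) p by (metis (mono_tags, lifting) infinite_super mem_Collect_eq subsetI)
  then have "p = 0"
    using poly_roots_finite by blast
  then show ?thesis
    by (simp add: p)
qed

text \<open>The coordinates are freed one at a time: \<open>X\<close> holds those already allowed to
  leave \<open>Q\<close>. With the others fixed, the function of the next coordinate is polynomial
  and vanishes on the infinite set \<open>Q\<close>, hence everywhere.\<close>

lemma separately_poly_eq_0:
  fixes F :: "('i \<Rightarrow> 'a::idom) \<Rightarrow> 'a"
  assumes poly: "\<And>w k. poly_fun (\<lambda>t. F (w(k := t)))" and Q: "infinite Q"
    and van: "\<And>w. (\<And>k. w k \<in> Q) \<Longrightarrow> F w = 0"
    and X: "finite X" "\<And>k. k \<notin> X \<Longrightarrow> w k \<in> Q"
  shows "F w = 0"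
  using X
proof (induction X arbitrary: w rule: finite_induct)
  case empty
  then show ?case
    using van by simp
next
  case (insert k X)
  have "F (w(k := t)) = 0" if "t \<in> Q" for t
    using insert that by (intro insert.IH) auto
  then have "F (w(k := w k)) = 0"
    by (rule poly_fun_eq_0[OF poly Q])
  then show ?case
    by simp
qed

section \<open>Polynomials vanishing at all complex points\<close>

text \<open>Reduction modulo \<open>M\<close> isolates the lowest digit; cancelling it and a factor
  \<open>M\<close> leaves an instance with one digit fewer.\<close>

lemma digits_unique:
  fixes c d :: "nat \<Rightarrow> nat"
  assumes "\<And>k. k < n \<Longrightarrow> c k < M" "\<And>k. k < n \<Longrightarrow> d k < M"
    and "(\<Sum>k<n. c k * M ^ k) = (\<Sum>k<n. d k * M ^ k)" and "k < n"
  shows "c k = d k"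
  using assms
proof (induction n arbitrary: c d k)
  case (Suc n)
  have eq: "(\<Sum>k<Suc n. e k * M ^ k) = e 0 + M * (\<Sum>k<n. e (Suc k) * M ^ k)" for e :: "nat \<Rightarrow> nat"
    unfolding sum.lessThan_Suc_shift by (simp add: sum_distrib_left mult_ac)
  have M: "c 0 < M" "d 0 < M"
    using Suc.prems by auto
  have E: "c 0 + M * (\<Sum>k<n. c (Suc k) * M ^ k) = d 0 + M * (\<Sum>k<n. d (Suc k) * M ^ k)"
    using Suc.prems(3) by (simp only: eq)
  have 0: "c 0 = d 0"
    using arg_cong[OF E, of "\<lambda>x. x mod M"] M by simp
  with E M have "(\<Sum>k<n. c (Suc k) * M ^ k) = (\<Sum>k<n. d (Suc k) * M ^ k)"
    by simp
  with Suc.IH[of "\<lambda>k. c (Suc k)" "\<lambda>k. d (Suc k)"] Suc.prems have "c (Suc k) = d (Suc k)" if "k < n" for k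
    using that by simp
  with 0 Suc.prems(4) show ?case
    by (cases k) auto
qed simp

text \<open>Kronecker substitution: for a base exceeding every exponent of \<open>g\<close>, distinct monomials become
  distinct powers of a single variable.\<close>

lemma gpoly_eq_0_if_vanishes:
  assumes keys: "\<And>m. m \<in> Poly_Mapping.keys g \<Longrightarrow>
      Poly_Mapping.keys (fst m) \<subseteq> {1..n} \<and> Poly_Mapping.keys (snd m) \<subseteq> {1..n}"
    and van: "\<And>x y. lin_eval (monom_eval n x y) g = 0"
  shows "g = 0"
proof -
  let ?E = "(\<lambda>(m, k). Poly_Mapping.lookup (fst m) k) ` (Poly_Mapping.keys g \<times> {1..n}) \<union>
     (\<lambda>(m, k). Poly_Mapping.lookup (snd m) k) ` (Poly_Mapping.keys g \<times> {1..n})"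
  obtain N where N: "\<And>e. e \<in> ?E \<Longrightarrow> e < N"
    using finite_nat_set_iff_bounded[of ?E] by auto
  have bound: "Poly_Mapping.lookup (fst m) k < N" "Poly_Mapping.lookup (snd m) k < N"
    if "m \<in> Poly_Mapping.keys g" "k \<in> {1..n}" for m k
    using that by (auto intro!: N)
  \<comment> \<open>Each digit in base \<open>N * N\<close> packs both exponents of one variable,
    themselves digits in base \<open>N\<close>. The \<open>Suc\<close> shifts variable indices from
    1..n to digit positions from 0.\<close>
  define dig where "dig m k = Poly_Mapping.lookup (fst m) (Suc k) + N * Poly_Mapping.lookup (snd m) (Suc k)"
    for m :: "multi_index \<times> multi_index" and k
  define code where "code m = (\<Sum>k<n. dig m k * (N * N) ^ k)" for m
  have eval: "monom_eval n (\<lambda>k. t ^ ((N * N) ^ (k - 1))) (\<lambda>k. t ^ (N * (N * N) ^ (k - 1))) m = t ^ code m" for t m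
    unfolding monom_eval_def code_def dig_def One_nat_def prod.atLeast1_atMost_eq power_sum
    by (simp add: prod.distrib[symmetric] power_add[symmetric] power_mult[symmetric] algebra_simps)
  have inj: "inj_on code (Poly_Mapping.keys g)"
  proof (rule inj_onI)
    fix m m' assume m: "m \<in> Poly_Mapping.keys g" "m' \<in> Poly_Mapping.keys g" "code m = code m'"
    have dig_less: "dig m k < N * N" if "m \<in> Poly_Mapping.keys g" "k < n" for m k
    proof -
      have "Poly_Mapping.lookup (fst m) (Suc k) < N" "Suc (Poly_Mapping.lookup (snd m) (Suc k)) \<le> N"
        using bound[OF that(1), of "Suc k"] that(2) by auto
      then have "dig m k < N + N * Poly_Mapping.lookup (snd m) (Suc k)"
        by (simp add: dig_def)
      also have "\<dots> = N * Suc (Poly_Mapping.lookup (snd m) (Suc k))"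
        by simp
      also have "\<dots> \<le> N * N"
        using \<open>Suc _ \<le> N\<close> by (rule mult_le_mono2)
      finally show ?thesis .
    qed
    have same: "Poly_Mapping.lookup (fst m) k = Poly_Mapping.lookup (fst m') k \<and>
        Poly_Mapping.lookup (snd m) k = Poly_Mapping.lookup (snd m') k" if k: "k \<in> {1..n}" for k
    proof -
      obtain l where l: "k = Suc l" "l < n"
        using k by (cases k) auto
      have "dig m l = dig m' l"
        using m l dig_less by (intro digits_unique[of n "dig m" "N * N" "dig m'"]) (auto simp: code_def)
      then have E: "Poly_Mapping.lookup (fst m) k + N * Poly_Mapping.lookup (snd m) k =
          Poly_Mapping.lookup (fst m') k + N * Poly_Mapping.lookup (snd m') k"
        by (simp add: dig_def l)
      have lt: "Poly_Mapping.lookup (fst m) k < N" "Poly_Mapping.lookup (fst m') k < N"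
        using bound m k by auto
      have "Poly_Mapping.lookup (fst m) k = Poly_Mapping.lookup (fst m') k"
        using arg_cong[OF E, of "\<lambda>x. x mod N"] lt by simp
      with E lt show ?thesis
        by simp
    qed
    \<comment> \<open>The code sees only indices in 1..n; all other exponents are zero.\<close>
    have out: "Poly_Mapping.lookup (fst m) k = 0 \<and> Poly_Mapping.lookup (snd m) k = 0"
      if "m \<in> Poly_Mapping.keys g" "k \<notin> {1..n}" for m k
      using keys[OF that(1)] that(2) by (auto simp: in_keys_iff)
    show "m = m'"
      using same out[OF m(1)] out[OF m(2)] by (intro prod_eqI poly_mapping_eqI) metis+
  qed
  \<comment> \<open>The image of \<open>g\<close> under the substitution. By \<open>inj\<close> no
    two terms merge, so every coefficient of \<open>g\<close> is a coefficient of
    \<open>p\<close>.\<close>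
  define p where "p = (\<Sum>m\<in>Poly_Mapping.keys g. monom (Poly_Mapping.lookup g m) (code m))"
  have "poly p t = lin_eval (monom_eval n (\<lambda>k. t ^ ((N * N) ^ (k - 1))) (\<lambda>k. t ^ (N * (N * N) ^ (k - 1)))) g" for t
    by (simp only: p_def poly_sum poly_monom lin_eval_def eval)
  then have "p = 0"
    by (simp add: van flip: poly_all_0_iff_0)
  have "Poly_Mapping.lookup g m = 0" if m: "m \<in> Poly_Mapping.keys g" for m
  proof -
    have "coeff p (code m) = (\<Sum>m'\<in>Poly_Mapping.keys g. if m' = m then Poly_Mapping.lookup g m' else 0)"
      unfolding p_def coeff_sum coeff_monom
      using inj m by (intro sum.cong) (auto simp: inj_on_def)
    then show ?thesis
      using m \<open>p = 0\<close> by simp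
  qed
  then show ?thesis
    by (intro poly_mapping_eqI) (metis in_keys_iff lookup_zero)
qed

section \<open>From points of K to all complex points\<close>

text \<open>In rational coordinates z = a + b sqrt(D), conjugation is the sign change of b, so
  evaluation is polynomial in the a and b. Vanishing extends to complex a and b, and then z and its
  conjugate can be prescribed independently.\<close>

lemma gen_poly_eq_0_if_geval_eq_0:
  assumes D: "D \<noteq> 0" "D \<noteq> 1" "squarefree D" and g: "g \<in> gen_polys D n"
    and van: "\<And>a. a \<in> {1..n} \<rightarrow> quad_field D \<Longrightarrow> geval D n g a = 0"
  shows "g = 0"
proof (rule gpoly_eq_0_if_vanishes)
  show "Poly_Mapping.keys (fst m) \<subseteq> {1..n} \<and> Poly_Mapping.keys (snd m) \<subseteq> {1..n}"
    if "m \<in> Poly_Mapping.keys g" for m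
    using gen_polysD[OF g] that by blast
next
  fix x y :: "nat \<Rightarrow> complex"
  \<comment> \<open>The tag \<open>False\<close> marks the coordinate a and \<open>True\<close> the
    coordinate b. The explicit sign change replaces \<open>tau\<close>, so \<open>F\<close> is
    polynomial also at irrational coordinates.\<close>
  define F where "F w = lin_eval (monom_eval n (\<lambda>k. w (False, k) + w (True, k) * sqrtD D)
      (\<lambda>k. w (False, k) - w (True, k) * sqrtD D)) g" for w :: "bool \<times> nat \<Rightarrow> complex"
  have sq: "sqrtD D \<noteq> 0"
    using D(1) by (simp add: sqrtD_def)
  \<comment> \<open>Solves x = a + b sqrt(D), y = a - b sqrt(D) for a and b. The default 0 is
    rational, so only finitely many coordinates have to be freed.\<close>
  define w where "w = (\<lambda>(b, k). if k \<in> {1..n} then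
      if b then (x k - y k) / (2 * sqrtD D) else (x k + y k) / 2 else 0)"
  have "F w = 0"
  proof (rule separately_poly_eq_0[where F = F and w = w and X = "UNIV \<times> {1..n}" and Q = "\<rat>"])
    fix w :: "bool \<times> nat \<Rightarrow> complex" and k
    have upd: "poly_fun (\<lambda>t. (w(k := t)) l)" for l
      by (cases "l = k") (auto intro: poly_fun_intros)
    show "poly_fun (\<lambda>t. F (w(k := t)))"
      unfolding F_def lin_eval_def monom_eval_def by (intro poly_fun_intros upd)
  next
    show "infinite (\<rat> :: complex set)"
      using infinite_super[OF Nats_subset_Rats] infinite_UNIV_char_0[where 'a = nat]
      by (simp add: Nats_def finite_image_iff inj_on_def)
  next
    fix w :: "bool \<times> nat \<Rightarrow> complex" assume "\<And>k. w k \<in> \<rat>"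
    then have "\<exists>r. w k = of_rat r" for k
      by (metis Rats_cases)
    then obtain r where r: "\<And>k. w k = of_rat (r k)"
      by metis
    have "geval D n g (\<lambda>k. w (False, k) + w (True, k) * sqrtD D) = 0"
      by (rule van) (auto simp: r quad_fieldI)
    then show "F w = 0"
      by (simp add: F_def geval_eq_lin_eval r tau_eq[OF D(3,2)])
  qed (auto simp: w_def split: if_splits)
  moreover have "monom_eval n (\<lambda>k. w (False, k) + w (True, k) * sqrtD D)
      (\<lambda>k. w (False, k) - w (True, k) * sqrtD D) = monom_eval n x y"
    unfolding monom_eval_def using sq
    by (intro ext arg_cong2[of _ _ _ _ "(*)"] prod.cong) (auto simp: w_def field_simps)
  ultimately show "lin_eval (monom_eval n x y) g = 0"
    by (simp add: F_def)
qed

section \<open>The two inclusions\<close>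

theorem theorem3p4:
  fixes D :: int and n :: nat
  assumes "D \<noteq> 0" and "D \<noteq> 1" and "squarefree D" and "n \<ge> 1"
  shows "Gamma_ring D n =
    rat_adjoin (\<Union>k\<in>{1..n}. {zvar k + tau_zvar k, gconst (sqrtD D) * (zvar k - tau_zvar k)})"
proof
  show sub: "rat_adjoin (gamma_gens D n) \<subseteq> Gamma_ring D n"
    using assms by (intro rat_adjoin_minimal gamma_gens_subset_Gamma_ring rat_subalgebra_Gamma_ring)
  show "Gamma_ring D n \<subseteq> rat_adjoin (gamma_gens D n)"
  proof
    fix g assume g: "g \<in> Gamma_ring D n"
    then have "g \<in> gen_polys D n"
      by (simp add: Gamma_ring_def)
    then obtain p q where p: "p \<in> rat_adjoin (gamma_gens D n)" and q: "q \<in> rat_adjoin (gamma_gens D n)"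
      and eq: "g = p + gconst (sqrtD D) * q"
      by (rule gen_polys_decomposition[OF assms(1)])
    have "q = 0"
    proof (rule gen_poly_eq_0_if_geval_eq_0[OF assms(1-3)])
      \<comment> \<open>The inclusion \<open>sub\<close> already places \<open>q\<close> in
        \<open>Gamma_ring D n\<close>.\<close>
      show "q \<in> gen_polys D n"
        using q sub by (auto simp: Gamma_ring_def)
    next
      fix a assume "a \<in> {1..n} \<rightarrow> quad_field D"
      then have "geval D n g a \<in> \<rat>" "geval D n p a \<in> \<rat>" "geval D n q a \<in> \<rat>"
        using g p q sub by (auto simp: Gamma_ring_def)
      then obtain r s t where r: "geval D n g a = of_rat r" "geval D n p a = of_rat s" "geval D n q a = of_rat t"
        by (auto elim!: Rats_cases)
      \<comment> \<open>Writing the value of \<open>g\<close> with zero coefficient at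
        \<open>sqrtD D\<close> lets uniqueness of coordinates force the value of \<open>q\<close> to
        be 0.\<close>
      have "of_rat r + of_rat 0 * sqrtD D = of_rat s + of_rat t * sqrtD D"
        using r eq by (simp add: geval_add geval_mult mult.commute)
      then show "geval D n q a = 0"
        using quad_repr_unique[OF assms(3,2)] r by fastforce
    qed
    with eq p show "g \<in> rat_adjoin (gamma_gens D n)"
      by simp
  qed
qed

end
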